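(* Let $T_n$ be a tree on $n\geq 8$ vertices. If the diameter $d(T_n)\geq \pi \sqrt[4]{\frac{7n}{8}}-1$, then $BH(T_n)> BH(K_{1,\, n-1})$.
   Context: $K_{1,n-1}$ is the star on $n$ vertices. For a graph $G$ on $n$ vertices with Laplacian $L(G)=D(G)-A(G)$ and Laplacian eigenvalues $0=\lambda_1\le\lambda_2\le\cdots\le\lambda_n$, the biharmonic index is $BH(G)=\frac12\sum_{u,v}d_B^2(u,v)$ ($d_B^2$ the squared biharmonic distance), equivalently $BH(G)=n\sum_{i=2}^n\lambda_i^{-2}$. $d(T_n)$ denotes the diameter of $T_n$. *)

theory Defs
  imports "HOL-Analysis.Analysis" "Graph_Theory.Digraph_Component" "Graph_Theory.Shortest_Path"
begin

text \<open>
  A finite simple graph is a \<open>pair_graph\<close>: a finite, loop-free digraph whose arc relation is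
  symmetric, so that an edge $\{u,v\}$ is the pair of arcs $(u,v)$ and $(v,u)$.  In this encoding
  every edge gives a closed walk of length 2 satisfying \<open>cycle\<close>, hence the library's \<open>forest\<close>
  and \<open>tree\<close> do not describe undirected trees.  Cycles of length at least 3 in the
  library's sense are exactly the undirected cycles.
\<close>

definition undirected_tree :: "'a pair_pre_digraph \<Rightarrow> bool" where
  "undirected_tree G \<longleftrightarrow>
     pair_graph G \<and> Digraph_Component.connected G \<and>
     \<not> (\<exists>p. pre_digraph.cycle G p \<and> 3 \<le> length p)"

definition graph_dist :: "'a pair_pre_digraph \<Rightarrow> 'a \<Rightarrow> 'a \<Rightarrow> ereal" where
  "graph_dist G u v = wf_digraph.\<mu> G (\<lambda>_. 1) u v"

definition graph_diameter :: "'a pair_pre_digraph \<Rightarrow> ereal" where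
  "graph_diameter G = (SUP u\<in>pverts G. SUP v\<in>pverts G. graph_dist G u v)"

text \<open>The star $K_{1,n-1}$ with centre \<open>c\<close>, on the whole of a type with $n$ elements.\<close>

definition star_graph :: "'n \<Rightarrow> 'n pair_pre_digraph" where
  "star_graph c = \<lparr> pverts = UNIV, parcs = {(u, v). u \<noteq> v \<and> (u = c \<or> v = c)} \<rparr>"

text \<open>
  The matrices below are indexed by a finite type and are intended for graphs whose vertex set is
  the whole type.
\<close>

definition adjacency_matrix :: "'n::finite pair_pre_digraph \<Rightarrow> real^'n^'n" where
  "adjacency_matrix G = (\<chi> u v. if (u, v) \<in> parcs G then 1 else 0)"

definition degree_matrix :: "'n::finite pair_pre_digraph \<Rightarrow> real^'n^'n" where
  "degree_matrix G = (\<chi> u v. if u = v then real (out_degree G u) else 0)"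

definition laplacian :: "'n::finite pair_pre_digraph \<Rightarrow> real^'n^'n" where
  "laplacian G = degree_matrix G - adjacency_matrix G"

text \<open>The Moore-Penrose inverse: the unique solution of the four Penrose equations.\<close>

definition moore_penrose :: "real^'n::finite^'m::finite \<Rightarrow> real^'m^'n" where
  "moore_penrose A = (THE X.
     A ** X ** A = A \<and> X ** A ** X = X \<and>
     transpose (A ** X) = A ** X \<and> transpose (X ** A) = X ** A)"

definition biharmonic_dist :: "'n::finite pair_pre_digraph \<Rightarrow> 'n \<Rightarrow> 'n \<Rightarrow> real" where
  "biharmonic_dist G u v =
     (let Q = moore_penrose (laplacian G ** laplacian G)
      in sqrt (Q $ u $ u + Q $ v $ v - 2 * Q $ u $ v))"

text \<open>
  The sum ranges over ordered pairs, so the factor $1/2$ makes each unordered pair count once.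
  For a connected graph with Laplacian eigenvalues $0 = \lambda_1 < \lambda_2 \le \dots \le
  \lambda_n$ it evaluates to $n \sum_{i=2}^n \lambda_i^{-2}$, because the all-ones vector spans
  the kernel of the Laplacian.
\<close>

definition biharmonic_index :: "'n::finite pair_pre_digraph \<Rightarrow> real" where
  "biharmonic_index G = 1 / 2 * (\<Sum>u\<in>UNIV. \<Sum>v\<in>UNIV. (biharmonic_dist G u v)\<^sup>2)"

end

theory Submission
  imports Defs
begin

text \<open>
  Let \<open>M\<close> be the Moore-Penrose inverse of the Laplacian, so that the biharmonic index is \<open>n\<close> times
  the squared Frobenius norm of \<open>M\<close>.  In a tree the resistance
  \<open>M\<^sub>u\<^sub>u + M\<^sub>v\<^sub>v - 2 M\<^sub>u\<^sub>v\<close> is the distance of \<open>u\<close> and \<open>v\<close>.  There are \<open>n - 1\<close> pairs at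
  distance 1 and all others are at distance at least 2, hence \<open>tr M \<ge> (n - 1)\<^sup>2 / n\<close>, with equality
  for the star.  Testing \<open>M\<close> against a rank-one perturbation of the centering matrix that sees
  a single pair of vertices at distance \<open>r\<close> gives \<open>\<parallel>M\<parallel>\<^sup>2 \<ge> 2 tr M + r - n - 2\<close>, which exceeds the
  value \<open>n - 2 + 1 / n\<^sup>2\<close> of the star as soon as \<open>r \<ge> 4\<close>.
\<close>

section \<open>The Laplacian and its pseudoinverse\<close>

text \<open>Uniqueness of the solution: transposing \<open>A ** X = (A ** Y) ** (A ** X)\<close>
  reverses the two symmetric factors, which collapses to \<open>A ** X = A ** Y\<close>; likewise
  \<open>X ** A = Y ** A\<close>.\<close>

lemma moore_penrose_eqI:
  fixes A :: "real^'n::finite^'m::finite"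
  assumes "A ** X ** A = A" "X ** A ** X = X"
    and "transpose (A ** X) = A ** X" "transpose (X ** A) = X ** A"
  shows "moore_penrose A = X"
  unfolding moore_penrose_def
proof (rule the_equality, goal_cases)
  case 1
  show ?case using assms by blast
next
  case (2 Y)
  then have Y: "A ** Y ** A = A" "Y ** A ** Y = Y"
    "transpose (A ** Y) = A ** Y" "transpose (Y ** A) = Y ** A" by blast+
  have "A ** X = (A ** Y) ** (A ** X)"
    using Y(1) by (simp add: matrix_mul_assoc)
  then have "transpose (A ** X) = transpose (A ** X) ** transpose (A ** Y)"
    by (metis matrix_transpose_mul)
  then have AX: "A ** X = A ** Y"
    using assms(1,3) Y(3) by (simp add: matrix_mul_assoc)
  have "X ** A = (X ** A) ** (Y ** A)"
    using Y(1) by (metis matrix_mul_assoc)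
  then have "transpose (X ** A) = transpose (Y ** A) ** transpose (X ** A)"
    by (metis matrix_transpose_mul)
  then have XA: "X ** A = Y ** A"
    using assms(1,4) Y(4) by (metis matrix_mul_assoc)
  have "X = X ** (A ** X)" using assms(2) by (simp add: matrix_mul_assoc)
  also have "\<dots> = (X ** A) ** Y" using AX by (simp add: matrix_mul_assoc)
  also have "\<dots> = Y" using XA Y(2) by simp
  finally show ?case by simp
qed

text \<open>The orthogonal projection onto the constant vectors; \<open>centering\<close> projects
  onto the vectors with sum zero.\<close>

definition averaging :: "real^'n::finite^'n" where
  "averaging = (\<chi> i j. 1 / real CARD('n))"

abbreviation centering :: "real^'n::finite^'n" where
  "centering \<equiv> mat 1 - averaging"

lemma matrix_add_rdistrib: "(B + C) ** (A :: real^'m::finite^'k::finite) = B ** A + C ** A"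
  by (simp add: matrix_matrix_mult_def vec_eq_iff distrib_right sum.distrib)

lemma matrix_sub_ldistrib: "(A :: real^'m::finite^'k::finite) ** (B - C) = A ** B - A ** C"
  by (simp add: matrix_matrix_mult_def vec_eq_iff right_diff_distrib sum_subtractf)

lemma matrix_sub_rdistrib: "(B - C) ** (A :: real^'m::finite^'k::finite) = B ** A - C ** A"
  by (simp add: matrix_matrix_mult_def vec_eq_iff left_diff_distrib sum_subtractf)

lemma averaging_idem [simp]: "averaging ** averaging = averaging"
  by (simp add: averaging_def matrix_matrix_mult_def vec_eq_iff)

lemma transpose_averaging [simp]: "transpose averaging = averaging"
  by (simp add: averaging_def transpose_def)

lemma mult_averaging_eq_0_iff:
  "(M :: real^'n::finite^'n) ** averaging = 0 \<longleftrightarrow> (\<forall>u. (\<Sum>v\<in>UNIV. M $ u $ v) = 0)"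
  by (simp add: averaging_def matrix_matrix_mult_def vec_eq_iff flip: sum_divide_distrib)

lemma transpose_add: "transpose (A + B) = transpose A + transpose (B :: real^'n^'m)"
  by (simp add: transpose_def vec_eq_iff)

lemma transpose_diff: "transpose (A - B) = transpose A - transpose (B :: real^'n^'m)"
  by (simp add: transpose_def vec_eq_iff)

text \<open>These conditions make \<open>M\<close> the Moore-Penrose inverse of \<open>L\<close> for
  an \<open>L\<close> whose kernel is the constants, in a form that avoids the definite
  description.\<close>

definition laplacian_pinv :: "real^'n::finite^'n \<Rightarrow> real^'n^'n \<Rightarrow> bool" where
  "laplacian_pinv L M \<longleftrightarrow> transpose L = L \<and> transpose M = M \<and>
     L ** averaging = 0 \<and> M ** averaging = 0 \<and> L ** M = centering"

lemma averaging_mult_eq_0: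
  assumes "transpose M = M" "M ** averaging = 0"
  shows "averaging ** M = 0"
proof -
  have "averaging ** M = transpose (M ** averaging)"
    by (simp add: matrix_transpose_mul assms(1))
  then show ?thesis by (simp add: assms(2)) (simp add: transpose_def vec_eq_iff)
qed

lemma laplacian_pinvD:
  assumes "laplacian_pinv L M"
  shows "transpose L = L" "transpose M = M" "L ** averaging = 0" "M ** averaging = 0"
    "averaging ** L = 0" "averaging ** M = 0" "L ** M = centering" "M ** L = centering"
proof -
  show *: "transpose L = L" "transpose M = M" "L ** averaging = 0" "M ** averaging = 0"
    "L ** M = centering"
    using assms by (auto simp: laplacian_pinv_def)
  show "averaging ** L = 0" "averaging ** M = 0"
    using * averaging_mult_eq_0 by auto
  show "M ** L = centering"
    using * matrix_transpose_mul[of L M] by (simp add: transpose_diff)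
qed

text \<open>Since \<open>averaging\<close> annihilates \<open>L\<close> and \<open>M\<close>,
  \<open>centering\<close> acts on them as an identity, so the inner factors of each product
  collapse.\<close>

lemma moore_penrose_square_laplacian:
  assumes "laplacian_pinv L M"
  shows "moore_penrose (L ** L) = M ** M"
proof -
  note * = laplacian_pinvD[OF assms]
  have 1: "(L ** L) ** (M ** M) = centering"
  proof -
    have "(L ** L) ** (M ** M) = L ** ((L ** M) ** M)"
      by (simp add: matrix_mul_assoc)
    then show ?thesis by (simp add: * matrix_sub_rdistrib)
  qed
  have 2: "(M ** M) ** (L ** L) = centering"
  proof -
    have "(M ** M) ** (L ** L) = M ** ((M ** L) ** L)"
      by (simp add: matrix_mul_assoc)
    then show ?thesis by (simp add: * matrix_sub_rdistrib)
  qed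
  have "averaging ** (L ** L) = 0" "averaging ** (M ** M) = 0"
    by (simp_all add: * matrix_mul_assoc)
  then show ?thesis
    by (intro moore_penrose_eqI) (simp_all add: 1 2 matrix_sub_rdistrib transpose_diff)
qed

text \<open>The squared distance is the squared norm of a difference of two rows of
  \<open>M\<close>. The columns of \<open>M\<close> sum to zero, so the cross terms vanish on
  summing over all pairs.\<close>

lemma biharmonic_index_pinv:
  fixes G :: "'n::finite pair_pre_digraph"
  assumes "laplacian_pinv (laplacian G) M"
  shows "biharmonic_index G = real CARD('n) * (\<Sum>u\<in>UNIV. \<Sum>v\<in>UNIV. (M $ u $ v)\<^sup>2)"
proof -
  note * = laplacian_pinvD[OF assms]
  have sym: "M $ u $ v = M $ v $ u" for u v
    using *(2) by (metis transpose_def vec_lambda_beta)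
  have col: "(\<Sum>u\<in>UNIV. M $ u $ w) = 0" for w
    using *(4) by (simp add: mult_averaging_eq_0_iff sym[of _ w])
  have Q: "(M ** M) $ u $ v = (\<Sum>w\<in>UNIV. M $ u $ w * M $ v $ w)" for u v
    by (simp add: matrix_matrix_mult_def sym)
  have d: "(biharmonic_dist G u v)\<^sup>2 = (\<Sum>w\<in>UNIV. (M $ u $ w - M $ v $ w)\<^sup>2)" for u v
  proof -
    have "(M ** M) $ u $ u + (M ** M) $ v $ v - 2 * (M ** M) $ u $ v
        = (\<Sum>w\<in>UNIV. (M $ u $ w - M $ v $ w)\<^sup>2)"
      unfolding Q sum_distrib_left sum.distrib[symmetric] sum_subtractf[symmetric]
      by (rule sum.cong) (auto simp: power2_eq_square algebra_simps)
    then show ?thesis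
      unfolding biharmonic_dist_def moore_penrose_square_laplacian[OF assms]
      by (simp add: sum_nonneg)
  qed
  have "(\<Sum>u\<in>UNIV. \<Sum>v\<in>UNIV. (biharmonic_dist G u v)\<^sup>2)
      = (\<Sum>u\<in>UNIV. \<Sum>w\<in>UNIV. \<Sum>v\<in>UNIV. (M $ u $ w - M $ v $ w)\<^sup>2)"
    unfolding d by (intro sum.cong refl sum.swap)
  also have "\<dots> = (\<Sum>w\<in>UNIV. \<Sum>u\<in>UNIV. \<Sum>v\<in>UNIV. (M $ u $ w - M $ v $ w)\<^sup>2)"
    by (rule sum.swap)
  also have "\<dots> = (\<Sum>w\<in>UNIV. 2 * real CARD('n) * (\<Sum>u\<in>UNIV. (M $ u $ w)\<^sup>2))"
    by (rule sum.cong)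
      (simp_all add: power2_diff sum.distrib sum_subtractf col
        flip: sum_distrib_left sum_distrib_right)
  also have "\<dots> = 2 * real CARD('n) * (\<Sum>u\<in>UNIV. \<Sum>v\<in>UNIV. (M $ u $ v)\<^sup>2)"
    by (subst sum.swap) (simp add: sum_distrib_left)
  finally show ?thesis by (simp add: biharmonic_index_def)
qed

text \<open>Adding \<open>averaging\<close> repairs the kernel of \<open>L\<close>; the inverse of
  the sum, minus \<open>averaging\<close>, is the required matrix.\<close>

lemma ex_laplacian_pinv:
  fixes L :: "real^'n::finite^'n"
  assumes "transpose L = L" "L ** averaging = 0"
    and ker: "\<And>f u v. L *v f = 0 \<Longrightarrow> f $ u = f $ v"
  shows "\<exists>M. laplacian_pinv L M"
proof -
  let ?K = "averaging :: real^'n^'n"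
  have KL: "?K ** L = 0" using assms(1,2) by (rule averaging_mult_eq_0)
  \<comment> \<open>Applying \<open>averaging\<close> removes the \<open>L\<close> part, so
    \<open>f\<close> has mean zero and lies in the kernel of \<open>L\<close>; it is then constant
    and equal to its mean.\<close>
  have "f = 0" if f: "(L + ?K) *v f = 0" for f
  proof -
    have "?K *v f = ?K *v ((L + ?K) *v f)"
      by (simp add: matrix_vector_mul_assoc matrix_add_ldistrib KL)
    then have Kf: "?K *v f = 0" using f by simp
    with f have "L *v f = 0" by (simp add: matrix_vector_mult_add_rdistrib)
    then have const: "f $ u = f $ v" for u v by (rule ker)
    have "f $ u = 0" for u
    proof -
      have "(?K *v f) $ u = (\<Sum>v\<in>UNIV. f $ v / real CARD('n))"
        by (simp add: averaging_def matrix_vector_mult_def)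
      also have "\<dots> = (\<Sum>v\<in>(UNIV :: 'n set). f $ u / real CARD('n))"
        by (intro sum.cong refl arg_cong2[where f = "(/)"] const)
      finally have "(?K *v f) $ u = f $ u" by simp
      then show ?thesis by (simp add: Kf)
    qed
    then show ?thesis by (simp add: vec_eq_iff)
  qed
  then obtain N where NL: "N ** (L + ?K) = mat 1"
    using matrix_left_invertible_ker[of "L + ?K"] by auto
  then have LN: "(L + ?K) ** N = mat 1" by (simp add: matrix_left_right_inverse)
  have NK: "N ** ?K = ?K"
  proof -
    have "?K = (N ** (L + ?K)) ** ?K" by (simp add: NL)
    also have "\<dots> = N ** ((L + ?K) ** ?K)" by (simp add: matrix_mul_assoc)
    also have "(L + ?K) ** ?K = ?K" by (simp add: matrix_add_rdistrib assms)
    finally show ?thesis by simp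
  qed
  have tN: "transpose N = N"
  proof -
    have "transpose N ** (L + ?K) = mat 1"
      using arg_cong[OF LN, of transpose] assms(1)
      by (simp add: matrix_transpose_mul transpose_mat transpose_add)
    then have "transpose N ** ((L + ?K) ** N) = N"
      by (simp add: matrix_mul_assoc)
    then show ?thesis using LN by simp
  qed
  have KN: "?K ** N = ?K"
    using arg_cong[OF NK, of transpose] by (simp add: matrix_transpose_mul tN)
  have "L ** N = centering" using LN by (simp add: matrix_add_rdistrib KN eq_diff_eq)
  then have "laplacian_pinv L (N - ?K)"
    by (simp add: laplacian_pinv_def assms matrix_sub_ldistrib matrix_sub_rdistrib NK
        transpose_diff tN)
  then show ?thesis ..
qed

section \<open>Graph Laplacian, Dirichlet form and kernel\<close>

lemma laplacian_mult_nth: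
  fixes G :: "'n::finite pair_pre_digraph"
  shows "(laplacian G *v f) $ u = (\<Sum>v | (u, v) \<in> parcs G. f $ u - f $ v)"
proof -
  have "out_arcs G u = Pair u ` {v. (u, v) \<in> parcs G}"
    by (auto simp: image_iff)
  then have deg: "out_degree G u = card {v. (u, v) \<in> parcs G}"
    by (simp add: out_degree_def card_image inj_on_def)
  have "(laplacian G *v f) $ u = (\<Sum>v\<in>UNIV. (if u = v then real (out_degree G u) * f $ v else 0)
      - (if (u, v) \<in> parcs G then f $ v else 0))"
    unfolding matrix_vector_mult_def laplacian_def degree_matrix_def adjacency_matrix_def
    by (auto simp: left_diff_distrib intro!: sum.cong)
  also have "\<dots> = real (out_degree G u) * f $ u - (\<Sum>v | (u, v) \<in> parcs G. f $ v)"
    by (simp add: sum_subtractf sum.If_cases)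
  finally show ?thesis by (simp add: deg sum_subtractf)
qed

lemma laplacian_mult_averaging: "laplacian G ** averaging = 0"
proof -
  have "(laplacian G *v 1) $ u = 0" for u
    by (simp add: laplacian_mult_nth)
  then show ?thesis by (simp add: mult_averaging_eq_0_iff matrix_vector_mult_def)
qed

lemma transpose_laplacian:
  assumes "sym (parcs G)"
  shows "transpose (laplacian G) = laplacian G"
  using assms
  by (auto simp: transpose_def laplacian_def degree_matrix_def adjacency_matrix_def vec_eq_iff
      dest: symD)

lemma sum_arcs_swap:
  fixes E :: "'n::finite rel"
  assumes "sym E"
  shows "(\<Sum>u\<in>UNIV. \<Sum>v | (u, v) \<in> E. g u v) = (\<Sum>u\<in>UNIV. \<Sum>v | (u, v) \<in> E. (g v u :: real))"
proof -
  have "(\<Sum>u\<in>UNIV. \<Sum>v | (u, v) \<in> E. g u v) = (\<Sum>u\<in>UNIV. \<Sum>v\<in>UNIV. if (u, v) \<in> E then g u v else 0)"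
    by (simp add: sum.If_cases)
  also have "\<dots> = (\<Sum>v\<in>UNIV. \<Sum>u\<in>UNIV. if (u, v) \<in> E then g u v else 0)"
    by (rule sum.swap)
  also have "\<dots> = (\<Sum>v\<in>UNIV. \<Sum>u\<in>UNIV. if (v, u) \<in> E then g u v else 0)"
    using assms by (auto dest: symD intro!: sum.cong)
  finally show ?thesis by (simp add: sum.If_cases)
qed

text \<open>Reversing all arcs gives a second expression for the same form; adding the two completes
  the square. Each edge occurs as two arcs, whence the division by 2.\<close>

lemma dirichlet_form:
  assumes "sym (parcs G)"
  shows "f \<bullet> (laplacian G *v f) = (\<Sum>u\<in>UNIV. \<Sum>v | (u, v) \<in> parcs G. (f $ u - f $ v)\<^sup>2) / 2"
proof -
  have 1: "f \<bullet> (laplacian G *v f) = (\<Sum>u\<in>UNIV. \<Sum>v | (u, v) \<in> parcs G. f $ u * (f $ u - f $ v))"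
    by (simp add: inner_vec_def laplacian_mult_nth sum_distrib_left)
  then have 2: "f \<bullet> (laplacian G *v f) = (\<Sum>u\<in>UNIV. \<Sum>v | (u, v) \<in> parcs G. f $ v * (f $ v - f $ u))"
    using sum_arcs_swap[OF assms] by simp
  have "2 * (f \<bullet> (laplacian G *v f)) = (\<Sum>u\<in>UNIV. \<Sum>v | (u, v) \<in> parcs G.
      f $ u * (f $ u - f $ v) + f $ v * (f $ v - f $ u))"
    unfolding sum.distrib using 1 2 by simp
  also have "\<dots> = (\<Sum>u\<in>UNIV. \<Sum>v | (u, v) \<in> parcs G. (f $ u - f $ v)\<^sup>2)"
    by (simp add: power2_eq_square algebra_simps)
  finally show ?thesis by simp
qed

text \<open>Zero Dirichlet energy forces \<open>f\<close> to agree across every arc, hence along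
  every walk.\<close>

lemma laplacian_kernel:
  assumes "sym (parcs G)" and conn: "\<And>u v. (u, v) \<in> (parcs G)\<^sup>*"
    and "laplacian G *v f = 0"
  shows "f $ u = f $ v"
proof -
  have "(\<Sum>u\<in>UNIV. \<Sum>v | (u, v) \<in> parcs G. (f $ u - f $ v)\<^sup>2) = 0"
    using dirichlet_form[OF assms(1), of f] assms(3) by simp
  then have edge: "f $ x = f $ y" if "(x, y) \<in> parcs G" for x y
    using that by (simp add: sum_nonneg_eq_0_iff sum_nonneg)
  from conn[of u v] show ?thesis by induction (auto dest: edge)
qed

section \<open>Effective resistance with unit resistors on the edges\<close>

definition resistance :: "real^'n^'n \<Rightarrow> 'n \<Rightarrow> 'n \<Rightarrow> real" where
  "resistance M u v = M $ u $ u + M $ v $ v - 2 * M $ u $ v"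

text \<open>Applying \<open>M\<close> to \<open>L *v f\<close> recovers \<open>f\<close> up to its
  mean, which cancels in the difference.\<close>

lemma resistance_eq_potential_diff:
  assumes "laplacian_pinv L M" and f: "L *v f = axis v 1 - axis u 1"
  shows "resistance M u v = f $ v - f $ u"
proof -
  note * = laplacian_pinvD[OF assms(1)]
  have sym: "M $ u $ v = M $ v $ u" for u v
    using *(2) by (metis transpose_def vec_lambda_beta)
  define c where "c = (\<Sum>j\<in>UNIV. f $ j / real CARD('a))"
  have "M *v (L *v f) = f - averaging *v f"
    by (simp add: matrix_vector_mul_assoc * matrix_vector_mult_diff_rdistrib)
  then have 1: "M *v (axis v 1 - axis u 1) = f - averaging *v f"
    by (simp add: f)
  have "M $ w $ v - M $ w $ u = f $ w - c" for w
    using arg_cong[OF 1, of "\<lambda>x. x $ w"]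
    by (simp add: matrix_vector_mult_diff_distrib matrix_vector_mult_basis column_def)
      (simp add: c_def averaging_def matrix_vector_mult_def)
  from this[of v] this[of u] show ?thesis
    by (simp add: resistance_def sym[of v u])
qed

section \<open>Resistances in trees\<close>

lemma undirected_treeD:
  assumes "undirected_tree T"
  shows "pair_graph T" "sym (parcs T)" "\<And>u. (u, u) \<notin> parcs T"
proof -
  show "pair_graph T" using assms by (simp add: undirected_tree_def)
  then interpret pair_graph T .
  show "sym (parcs T)" using pair_sym_arcs by (simp add: symmetric_def)
  show "(u, u) \<notin> parcs T" for u using no_loops' by blast
qed

lemma undirected_tree_reachable:
  assumes "undirected_tree T" "u \<in> pverts T" "v \<in> pverts T"
  shows "(u, v) \<in> (parcs T)\<^sup>*"
proof -
  interpret pair_graph T using assms(1) by (rule undirected_treeD)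
  have "strongly_connected (with_proj T)"
    using assms(1) symmetric_connected_imp_strongly_connected[OF pair_sym_arcs]
    by (simp add: undirected_tree_def)
  then have "(u, v) \<in> rtrancl_on (pverts T) (parcs T)"
    using assms(2,3) by (auto simp: strongly_connected_def reachable_def)
  then show ?thesis by induction auto
qed

text \<open>A path from \<open>v\<close> to \<open>u\<close> avoiding the edge would close up with
  the arc \<open>(u, v)\<close> to a cycle of length at least 3.\<close>

lemma undirected_tree_bridge:
  assumes "undirected_tree T" and uv: "(u, v) \<in> parcs T"
  shows "(v, u) \<notin> (parcs T - {(u, v), (v, u)})\<^sup>*"
proof
  assume *: "(v, u) \<in> (parcs T - {(u, v), (v, u)})\<^sup>*"
  interpret pair_graph T using assms(1) by (rule undirected_treeD)
  have ends: "u \<in> pverts T" "v \<in> pverts T" "u \<noteq> v"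
    using uv no_loops' by (auto dest: in_arcsD1 in_arcsD2)
  let ?H = "\<lparr> pverts = pverts T, parcs = parcs T - {(u, v), (v, u)} \<rparr>"
  interpret H: pair_wf_digraph ?H
    by unfold_locales (auto dest: in_arcsD1 in_arcsD2)
  have "(v, x) \<in> rtrancl_on (pverts T) (parcs ?H)" if "(v, x) \<in> (parcs ?H)\<^sup>*" for x
    using that
  proof induction
    case (step y z)
    then show ?case by (auto dest: in_arcsD2 intro: rtrancl_on_into_rtrancl_on)
  qed (use ends in simp)
  then have "reachable (with_proj ?H) v u"
    using * by (simp add: reachable_def)
  then obtain p where "H.apath v p u" using H.reachable_apath by auto
  then have p: "set p \<subseteq> parcs T - {(u, v), (v, u)}" "pcas v p u" "distinct (pawalk_verts v p)"
    by (auto simp: H.apath_def H.awalk_def)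
  \<comment> \<open>A path of length 0 would give \<open>u = v\<close>; a path of length 1 would be
    the deleted arc \<open>(v, u)\<close>.\<close>
  have "2 \<le> length p"
  proof (rule ccontr)
    assume "\<not> ?thesis"
    then consider "p = []" | e where "p = [e]"
      by (cases p; cases "tl p") auto
    then show False using p(1,2) ends by cases (auto simp: prod_eq_iff)
  qed
  moreover have "cycle ((u, v) # p)"
    unfolding cycle_def awalk_def using p uv ends by (intro exI[of _ u]) auto
  ultimately show False
    using assms(1) by (force simp: undirected_tree_def)
qed

text \<open>Links the extended-real distance to powers of the arc relation, in which tree distances
  are expressed below.\<close>

lemma graph_dist_le_relpow:
  assumes "pair_graph T" "u \<in> pverts T" "(u, v) \<in> parcs T ^^ k"
  shows "graph_dist T u v \<le> ereal (real k)"
proof -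
  interpret pair_graph T by fact
  have "\<exists>p. awalk u p v \<and> length p = k"
    using assms(2,3)
  proof (induction k arbitrary: u)
    case 0
    then show ?case by (auto simp: awalk_Nil_iff)
  next
    case (Suc k)
    then obtain w where w: "(u, w) \<in> parcs T" "(w, v) \<in> parcs T ^^ k"
      by (meson relpow_Suc_D2)
    with Suc.IH[of w] obtain p where "awalk w p v" "length p = k"
      by (auto dest: in_arcsD2)
    then show ?case using w(1) by (intro exI[of _ "(u, w) # p"]) (auto simp: awalk_Cons_iff)
  qed
  then obtain p where p: "awalk u p v" "length p = k" by blast
  have "awalk_cost (\<lambda>_. 1) p = real (length p)"
    by (simp add: awalk_cost_def sum_list_triv)
  then show ?thesis
    using min_cost_le_walk_cost[OF p(1), of "\<lambda>_. 1"] p(2) by (simp add: graph_dist_def)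
qed

text \<open>The edge \<open>{w, v}\<close> is the only one leaving the set with indicator function \<open>b\<close>.\<close>

lemma laplacian_cut_potential:
  fixes T :: "'n::finite pair_pre_digraph"
  assumes "undirected_tree T" "(w, v) \<in> parcs T"
  defines "F \<equiv> parcs T - {(w, v), (v, w)}"
  defines "b \<equiv> (\<chi> x. if (v, x) \<in> F\<^sup>* then 1 else (0 :: real))"
  shows "laplacian T *v b = axis v 1 - axis w 1"
proof -
  note T = undirected_treeD[OF assms(1)]
  have symF: "sym F" using T(2) by (auto simp: F_def sym_def)
  have w: "(v, w) \<notin> F\<^sup>*"
    using undirected_tree_bridge[OF assms(1,2)] by (simp add: F_def)
  have vw: "v \<noteq> w" using T(3) assms(2) by auto
  have vw': "(v, w) \<in> parcs T" using T(2) assms(2) by (rule symD)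
  have inF: "(v, x) \<in> F\<^sup>* \<longleftrightarrow> (v, y) \<in> F\<^sup>*" if "(x, y) \<in> F" for x y
    using that symF by (meson rtrancl.rtrancl_into_rtrancl symD)
  have "(laplacian T *v b) $ x = (axis v 1 - axis w 1 :: real^'n) $ x" for x
  proof -
    \<comment> \<open>\<open>b\<close> is constant along arcs of \<open>F\<close>, so it changes
      only across the two removed arcs.\<close>
    have diff: "b $ x - b $ y =
        (if x = v \<and> y = w then 1 else if x = w \<and> y = v then - 1 else 0)"
      if "(x, y) \<in> parcs T" for y
    proof (cases "(x, y) \<in> F")
      case True
      then have "b $ x = b $ y" using inF by (simp add: b_def)
      then show ?thesis using True by (auto simp: F_def)
    next
      case False
      then show ?thesis using that w vw by (auto simp: F_def b_def)
    qed
    have "(laplacian T *v b) $ x = (\<Sum>y | (x, y) \<in> parcs T.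
        if x = v \<and> y = w then 1 else if x = w \<and> y = v then - 1 else 0)"
      unfolding laplacian_mult_nth by (intro sum.cong refl diff) simp
    also have "\<dots> = (axis v 1 - axis w 1 :: real^'n) $ x"
    proof -
      consider "x = v" | "x = w" | "x \<noteq> v" "x \<noteq> w" by blast
      then show ?thesis
        by cases (use vw vw' assms(2) in \<open>auto simp: axis_def cong: if_cong\<close>)
    qed
    finally show ?thesis .
  qed
  then show ?thesis by (simp add: vec_eq_iff)
qed

text \<open>A vertex on the walk is reached in at most \<open>k\<close> steps, so it cannot be
  \<open>v\<close>. This places \<open>u\<close> and \<open>w\<close> on the same side of a cut at
  \<open>v\<close>.\<close>

lemma relpow_avoiding:
  assumes "(u, w) \<in> E ^^ k" "\<And>j. j \<le> k \<Longrightarrow> (u, v) \<notin> E ^^ j"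
  shows "(u, w) \<in> {(x, y) \<in> E. x \<noteq> v \<and> y \<noteq> v}\<^sup>*"
  using assms
proof (induction k arbitrary: w)
  case 0
  then show ?case by simp
next
  case (Suc k)
  then obtain x where x: "(u, x) \<in> E ^^ k" "(x, w) \<in> E" by auto
  have "x \<noteq> v" using x(1) Suc.prems(2)[of k] by auto
  moreover have "w \<noteq> v" using Suc.prems by blast
  moreover have "(u, x) \<in> {(x, y) \<in> E. x \<noteq> v \<and> y \<noteq> v}\<^sup>*"
    using Suc.IH[OF x(1)] Suc.prems(2) by simp
  ultimately show ?case using x(2) by (auto intro: rtrancl_into_rtrancl)
qed

text \<open>Along a shortest walk the unit current from \<open>u\<close> to \<open>v\<close> is obtained by adding up the cut
  potentials of the edges.  The last edge is separated from the rest of the walk, so the reciprocity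
  \<open>b \<bullet> L f = L b \<bullet> f\<close> shows that \<open>f\<close> does not change along it.\<close>

lemma ex_tree_potential:
  fixes T :: "'n::finite pair_pre_digraph"
  assumes T: "undirected_tree T"
    and "(u, v) \<in> parcs T ^^ k" "\<And>j. j < k \<Longrightarrow> (u, v) \<notin> parcs T ^^ j"
  shows "\<exists>f. laplacian T *v f = axis v 1 - axis u 1 \<and> f $ v - f $ u = real k"
  using assms(2,3)
proof (induction k arbitrary: v)
  case 0
  then show ?case by (intro exI[of _ 0]) (auto simp: matrix_vector_mult_def vec_eq_iff)
next
  case (Suc k)
  note D = undirected_treeD[OF T]
  from Suc.prems obtain w where w: "(u, w) \<in> parcs T ^^ k" "(w, v) \<in> parcs T" by auto
  \<comment> \<open>A shorter walk to \<open>w\<close> would extend to a walk to \<open>v\<close>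
    with fewer than \<open>Suc k\<close> steps.\<close>
  have min: "(u, w) \<notin> parcs T ^^ j" if "j < k" for j
    using Suc.prems(2)[of "Suc j"] w(2) that by auto
  from Suc.IH[OF w(1) min] obtain f
    where f: "laplacian T *v f = axis w 1 - axis u 1" "f $ w - f $ u = real k" by blast
  define F where "F = parcs T - {(w, v), (v, w)}"
  define b where "b = (\<chi> x. if (v, x) \<in> F\<^sup>* then 1 else (0 :: real))"
  have b: "laplacian T *v b = axis v 1 - axis w 1"
    using laplacian_cut_potential[OF T w(2)] by (simp add: b_def F_def)
  have vw: "(v, w) \<notin> F\<^sup>*"
    using undirected_tree_bridge[OF T w(2)] by (simp add: F_def)
  have "(u, w) \<in> {(x, y) \<in> parcs T. x \<noteq> v \<and> y \<noteq> v}\<^sup>*"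
    using w(1) by (rule relpow_avoiding) (use Suc.prems(2) in auto)
  then have "(u, w) \<in> F\<^sup>*"
    by (rule rtrancl_mono[THEN subsetD, rotated]) (auto simp: F_def)
  then have vu: "(v, u) \<notin> F\<^sup>*" using vw by (meson rtrancl_trans)
  have "f $ v - f $ w = (laplacian T *v b) \<bullet> f"
    by (simp add: b inner_diff_left inner_axis')
  also have "\<dots> = b \<bullet> (laplacian T *v f)"
    using dot_lmul_matrix[of b "laplacian T" f] transpose_laplacian[OF D(2)]
    by (metis vector_transpose_matrix)
  \<comment> \<open>Both poles of \<open>f\<close>, namely \<open>u\<close> and \<open>w\<close>,
    lie on the side of the cut where \<open>b\<close> vanishes.\<close>
  also have "\<dots> = 0"
    using vw vu by (simp add: f inner_diff_right inner_axis b_def)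
  finally have "f $ v = f $ w" by simp
  \<comment> \<open>Adding \<open>b\<close> moves the sink from \<open>w\<close> to \<open>v\<close>
    and raises the potential difference by 1, as \<open>b\<close> is 1 at \<open>v\<close> and 0 at
    \<open>u\<close>.\<close>
  then show ?case
    using f b vu
    by (intro exI[of _ "f + b"]) (simp add: matrix_vector_right_distrib b_def)
qed

lemma resistance_tree:
  fixes T :: "'n::finite pair_pre_digraph"
  assumes "undirected_tree T" "laplacian_pinv (laplacian T) M"
    and "(u, v) \<in> parcs T ^^ k" "\<And>j. j < k \<Longrightarrow> (u, v) \<notin> parcs T ^^ j"
  shows "resistance M u v = real k"
  using ex_tree_potential[OF assms(1,3,4)] resistance_eq_potential_diff[OF assms(2)] by metis

lemma resistance_tree_ge:
  fixes T :: "'n::finite pair_pre_digraph"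
  assumes "undirected_tree T" "pverts T = UNIV" "laplacian_pinv (laplacian T) M"
    and "\<And>j. j < k \<Longrightarrow> (u, v) \<notin> parcs T ^^ j"
  shows "resistance M u v \<ge> real k"
proof -
  have ex: "\<exists>m. (u, v) \<in> parcs T ^^ m"
    using undirected_tree_reachable[OF assms(1)] assms(2) by (simp add: rtrancl_is_UN_relpow)
  define m where "m = (LEAST m. (u, v) \<in> parcs T ^^ m)"
  have "(u, v) \<in> parcs T ^^ m" unfolding m_def using ex by (rule LeastI_ex)
  moreover have "(u, v) \<notin> parcs T ^^ j" if "j < m" for j
    using that not_less_Least unfolding m_def by blast
  ultimately have "resistance M u v = real m" "k \<le> m"
    using resistance_tree[OF assms(1,3)] assms(4) by (blast, meson not_less)
  then show ?thesis by simp
qed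

section \<open>Comparison with the star\<close>

text \<open>Over ordered arcs the resistances add up to twice the trace of
  \<open>laplacian G ** M\<close>, which is the trace of \<open>centering\<close>.\<close>

lemma foster:
  fixes G :: "'n::finite pair_pre_digraph"
  assumes "sym (parcs G)" "laplacian_pinv (laplacian G) M"
  shows "(\<Sum>u\<in>UNIV. \<Sum>v | (u, v) \<in> parcs G. resistance M u v) = 2 * (real CARD('n) - 1)"
proof -
  note * = laplacian_pinvD[OF assms(2)]
  have sym: "M $ u $ v = M $ v $ u" for u v
    using *(2) by (metis transpose_def vec_lambda_beta)
  have "(\<Sum>u\<in>UNIV. \<Sum>v | (u, v) \<in> parcs G. resistance M u v)
      = (\<Sum>u\<in>UNIV. \<Sum>v | (u, v) \<in> parcs G. M $ u $ u - M $ v $ u)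
        + (\<Sum>u\<in>UNIV. \<Sum>v | (u, v) \<in> parcs G. M $ v $ v - M $ u $ v)"
    unfolding sum.distrib[symmetric] resistance_def
    by (intro sum.cong refl) (use sym in \<open>simp add: algebra_simps\<close>)
  also have "\<dots> = 2 * (\<Sum>u\<in>UNIV. \<Sum>v | (u, v) \<in> parcs G. M $ u $ u - M $ v $ u)"
    using sum_arcs_swap[OF assms(1), of "\<lambda>u v. M $ u $ u - M $ v $ u"] by simp
  also have "(\<Sum>u\<in>UNIV. \<Sum>v | (u, v) \<in> parcs G. M $ u $ u - M $ v $ u)
      = (\<Sum>u\<in>UNIV. (laplacian G *v column u M) $ u)"
    by (simp add: laplacian_mult_nth column_def)
  also have "\<dots> = trace (laplacian G ** M)"
    by (simp add: trace_def matrix_matrix_mult_def matrix_vector_mult_def column_def)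
  also have "\<dots> = real CARD('n) - 1"
    by (simp add: *(7) trace_sub trace_I) (simp add: trace_def averaging_def)
  finally show ?thesis .
qed

lemma sum_resistance:
  fixes M :: "real^'n::finite^'n"
  assumes "laplacian_pinv L M"
  shows "(\<Sum>u\<in>UNIV. \<Sum>v\<in>UNIV. resistance M u v) = 2 * real CARD('n) * trace M"
proof -
  have "(\<Sum>v\<in>UNIV. M $ u $ v) = 0" for u
    using laplacian_pinvD(4)[OF assms] by (simp add: mult_averaging_eq_0_iff)
  then show ?thesis
    by (simp add: resistance_def trace_def sum.distrib sum_subtractf
        flip: sum_distrib_left)
qed

text \<open>By Foster's theorem the \<open>n - 1\<close> edges contribute 1 each to the total resistance, and every
  other pair contributes at least 2.\<close>

lemma trace_pinv_tree_ge:
  fixes T :: "'n::finite pair_pre_digraph"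
  assumes "undirected_tree T" "pverts T = UNIV" "laplacian_pinv (laplacian T) M"
  shows "trace M \<ge> (real CARD('n) - 1)\<^sup>2 / real CARD('n)"
proof -
  note T = undirected_treeD[OF assms(1)]
  let ?n = "real CARD('n)"
  let ?e = "\<lambda>u v. if (u, v) \<in> parcs T then 1 else 0 :: real"
  have R1: "resistance M u v = 1" if "(u, v) \<in> parcs T" for u v
    using resistance_tree[OF assms(1,3), of u v 1] that T(3) by auto
  have R2: "resistance M u v \<ge> 2" if "u \<noteq> v" "(u, v) \<notin> parcs T" for u v
  proof -
    have "(u, v) \<notin> parcs T ^^ j" if "j < 2" for j
      using that \<open>u \<noteq> v\<close> \<open>(u, v) \<notin> parcs T\<close> by (auto simp: less_2_cases_iff)
    then show ?thesis using resistance_tree_ge[OF assms, of 2] by simp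
  qed
  have "(\<Sum>u\<in>UNIV. \<Sum>v\<in>UNIV. ?e u v) = (\<Sum>u\<in>UNIV. \<Sum>v | (u, v) \<in> parcs T. resistance M u v)"
    by (rule sum.cong[OF refl]) (simp add: sum.If_cases R1)
  then have edges: "(\<Sum>u\<in>UNIV. \<Sum>v\<in>UNIV. ?e u v) = 2 * (?n - 1)"
    using foster[OF T(2) assms(3)] by simp
  \<comment> \<open>A lower bound on each ordered pair: 0 on the diagonal, 1 on arcs, 2
    elsewhere.\<close>
  have "2 * ?n * ?n - 2 * ?n - 2 * (?n - 1)
      = (\<Sum>u\<in>UNIV. \<Sum>v\<in>UNIV. 2 - (if u = v then 2 else 0) - ?e u v)"
    by (simp add: sum_subtractf edges) (simp add: algebra_simps)
  also have "\<dots> \<le> (\<Sum>u\<in>UNIV. \<Sum>v\<in>UNIV. resistance M u v)"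
  proof (intro sum_mono)
    fix u v
    show "2 - (if u = v then 2 else 0) - ?e u v \<le> resistance M u v"
      using R1[of u v] R2[of u v] T(3)[of u] by (auto simp: resistance_def)
  qed
  also have "\<dots> = 2 * ?n * trace M" by (rule sum_resistance[OF assms(3)])
  finally have "(?n - 1)\<^sup>2 \<le> ?n * trace M" by (simp add: power2_eq_square algebra_simps)
  then show ?thesis by (simp add: divide_le_eq mult.commute)
qed

section \<open>Frobenius norm bound\<close>

lemma inner_outer_product:
  "A \<bullet> (\<chi> u v. x $ u * x $ v) = x \<bullet> (A *v (x :: real^'n::finite))"
  by (simp add: inner_vec_def matrix_vector_mult_def sum_distrib_left mult_ac)

lemma inner_mat_1: "A \<bullet> mat 1 = trace (A :: real^'n::finite^'n)"
  by (simp add: inner_vec_def mat_def trace_def if_distrib cong: if_cong)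

text \<open>Expanding \<open>\<parallel>M - N\<parallel>\<^sup>2 \<ge> 0\<close> for \<open>N = centering + x x\<^sup>T / 2\<close> with
  \<open>x = \<delta>\<^sub>v - \<delta>\<^sub>u\<close> bounds the Frobenius norm of \<open>M\<close>.  The choice \<open>N = centering\<close> alone would give
  \<open>n - 3 + 2 / n\<close> for a tree, just short of the value \<open>n - 2 + 1 / n\<^sup>2\<close> for the star.\<close>

lemma frobenius_pinv_ge:
  fixes M :: "real^'n::finite^'n"
  assumes "laplacian_pinv L M" "u \<noteq> v"
  shows "M \<bullet> M \<ge> 2 * trace M + resistance M u v - real CARD('n) - 2"
proof -
  note * = laplacian_pinvD[OF assms(1)]
  define x :: "real^'n" where "x = axis v 1 - axis u 1"
  define X :: "real^'n^'n" where "X = (\<chi> i j. x $ i * x $ j)"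
  have sym: "M $ u $ v = M $ v $ u"
    using *(2) by (metis transpose_def vec_lambda_beta)
  have xx: "x \<bullet> x = 2"
    using assms(2) by (simp add: x_def inner_diff_left inner_diff_right inner_axis_axis)
  have sumx: "(\<Sum>i\<in>UNIV. x $ i) = 0"
    by (simp add: x_def sum_subtractf axis_def)
  have Kx: "averaging *v x = 0"
    using sumx by (simp add: averaging_def matrix_vector_mult_def vec_eq_iff flip: sum_divide_distrib)
  have Xx: "X *v x = 2 *\<^sub>R x"
    using xx by (simp add: X_def matrix_vector_mult_def vec_eq_iff inner_vec_def mult.assoc
        flip: sum_distrib_left)
  have Mx: "M \<bullet> X = resistance M u v"
    unfolding X_def inner_outer_product
    by (simp add: x_def resistance_def matrix_vector_mult_diff_distrib matrix_vector_mult_basis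
        inner_diff_left inner_axis' column_def sym)
  have MK: "M \<bullet> averaging = 0"
  proof -
    have "M \<bullet> averaging = (\<Sum>i\<in>UNIV. (\<Sum>j\<in>UNIV. M $ i $ j) / real CARD('n))"
      by (simp add: inner_vec_def averaging_def sum_divide_distrib)
    then show ?thesis using *(4) by (simp add: mult_averaging_eq_0_iff)
  qed
  have others: "(mat 1 :: real^'n^'n) \<bullet> mat 1 = real CARD('n)"
    "(averaging :: real^'n^'n) \<bullet> mat 1 = 1" "(averaging :: real^'n^'n) \<bullet> averaging = 1"
    "X \<bullet> X = 4" "mat 1 \<bullet> X = 2" "averaging \<bullet> X = 0"
  proof -
    show "X \<bullet> X = 4" "mat 1 \<bullet> X = 2" "averaging \<bullet> X = 0"
      using inner_outer_product[of X x] inner_outer_product[of "mat 1" x]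
        inner_outer_product[of averaging x]
      by (simp_all add: Xx Kx xx flip: X_def)
    show "(mat 1 :: real^'n^'n) \<bullet> mat 1 = real CARD('n)"
      by (simp add: inner_mat_1 trace_I)
    show "(averaging :: real^'n^'n) \<bullet> mat 1 = 1"
      by (simp add: inner_mat_1 trace_def averaging_def)
    show "(averaging :: real^'n^'n) \<bullet> averaging = 1"
      by (simp add: inner_vec_def averaging_def)
  qed
  \<comment> \<open>The test matrix has squared norm \<open>(n - 1) + 2 + 1 = n + 2\<close>, and its
    inner product with \<open>M\<close> is the trace plus half the resistance.\<close>
  have "0 \<le> (M - (centering + (1 / 2) *\<^sub>R X)) \<bullet> (M - (centering + (1 / 2) *\<^sub>R X))"
    by (rule inner_ge_zero)
  then show ?thesis
    using Mx MK others
    by (simp add: inner_diff_left inner_diff_right inner_add_left inner_add_right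
        inner_commute[of "mat 1" M] inner_commute[of averaging M] inner_commute[of X M]
        inner_commute[of X "mat 1"] inner_commute[of X averaging]
        inner_commute[of "mat 1" averaging] inner_mat_1[of M])
      (simp add: field_simps)
qed

section \<open>Exact value for the star\<close>

lemma biharmonic_index_star:
  fixes c :: "'n::finite"
  assumes "CARD('n) \<ge> 2"
  shows "biharmonic_index (star_graph c) = real CARD('n) * (real CARD('n) - 2) + 1 / real CARD('n)"
proof -
  let ?n = "real CARD('n)"
  let ?L = "laplacian (star_graph c)"
  have n: "?n \<ge> 2" using assms by simp
  \<comment> \<open>Read off from the spectrum: eigenvalue 1 on vectors of sum zero supported on the
    leaves, and eigenvalue \<open>n\<close> on the vector that is \<open>n - 1\<close> at
    \<open>c\<close> and \<open>-1\<close> at each leaf.\<close>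
  define M :: "real^'n^'n" where
    "M = (\<chi> u v. if u = c then if v = c then 1 / ?n - 1 / ?n\<^sup>2 else - 1 / ?n\<^sup>2
       else if v = c then - 1 / ?n\<^sup>2 else (if u = v then 1 else 0) - 1 / ?n - 1 / ?n\<^sup>2)"
  have sum1: "(\<Sum>v\<in>UNIV. if v = c then a else b) = a + (?n - 1) * b" for a b :: real
  proof -
    have "(\<Sum>v\<in>UNIV. if v = c then a else b) = (\<Sum>v\<in>UNIV. (if v = c then a - b else 0) + b)"
      by (rule sum.cong) auto
    then show ?thesis by (simp add: sum.distrib algebra_simps)
  qed
  have sum2: "(\<Sum>v\<in>UNIV. if v = c then a else if u = v then d else b) = a + d + (?n - 2) * b"
    if "u \<noteq> c" for a b d :: real and u
  proof -
    have "(\<Sum>v\<in>UNIV. if v = c then a else if u = v then d else b)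
        = (\<Sum>v\<in>UNIV. (if v = c then a - b else 0) + (if u = v then d - b else 0) + b)"
      using that by (intro sum.cong) auto
    then show ?thesis by (simp add: sum.distrib algebra_simps)
  qed
  have M_sym: "M $ u $ v = M $ v $ u" for u v
    by (auto simp: M_def)
  have row: "(\<Sum>v\<in>UNIV. M $ u $ v) = 0" for u
  proof (cases "u = c")
    case True
    then show ?thesis using n
      by (simp add: M_def sum1) (simp add: field_simps power2_eq_square)
  next
    case False
    have "(\<Sum>v\<in>UNIV. M $ u $ v) = (\<Sum>v\<in>UNIV. if v = c then - 1 / ?n\<^sup>2
        else if u = v then 1 - 1 / ?n - 1 / ?n\<^sup>2 else - 1 / ?n - 1 / ?n\<^sup>2)"
      using False by (intro sum.cong) (auto simp: M_def)
    then show ?thesis using n False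
      by (simp add: sum2) (simp add: field_simps power2_eq_square)
  qed
  have "(?L *v column v M) $ u = (centering :: real^'n^'n) $ u $ v" for u v
  proof (cases "u = c")
    case True
    have "{w. (u, w) \<in> parcs (star_graph c)} = UNIV - {u}"
      using True by (auto simp: star_graph_def)
    then have "(?L *v column v M) $ u = (\<Sum>w\<in>UNIV. M $ u $ v - M $ w $ v)"
      by (simp add: laplacian_mult_nth column_def sum_diff1)
    also have "\<dots> = ?n * M $ u $ v"
      using row[of v] by (simp add: sum_subtractf M_sym[of _ v])
    also have "\<dots> = (centering :: real^'n^'n) $ u $ v"
      using n True by (auto simp: M_def averaging_def mat_def field_simps power2_eq_square)
    finally show ?thesis .
  next
    case False
    then have "{w. (u, w) \<in> parcs (star_graph c)} = {c}"
      by (auto simp: star_graph_def)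
    then show ?thesis
      using n False by (auto simp: laplacian_mult_nth column_def M_def averaging_def mat_def)
  qed
  then have "?L ** M = centering"
    by (simp add: vec_eq_iff matrix_matrix_mult_def matrix_vector_mult_def column_def)
  moreover have "sym (parcs (star_graph c))"
    by (auto simp: star_graph_def sym_def)
  ultimately have "laplacian_pinv ?L M"
    using row M_sym
    by (simp add: laplacian_pinv_def transpose_laplacian laplacian_mult_averaging
        mult_averaging_eq_0_iff) (simp add: transpose_def vec_eq_iff)
  then have "biharmonic_index (star_graph c) = ?n * (\<Sum>u\<in>UNIV. \<Sum>v\<in>UNIV. (M $ u $ v)\<^sup>2)"
    by (rule biharmonic_index_pinv)
  also have "(\<Sum>u\<in>UNIV. \<Sum>v\<in>UNIV. (M $ u $ v)\<^sup>2) = (\<Sum>u\<in>UNIV. if u = c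
      then (1 / ?n - 1 / ?n\<^sup>2)\<^sup>2 + (?n - 1) * (1 / ?n\<^sup>2)\<^sup>2
      else (1 / ?n\<^sup>2)\<^sup>2 + (1 - 1 / ?n - 1 / ?n\<^sup>2)\<^sup>2 + (?n - 2) * (1 / ?n + 1 / ?n\<^sup>2)\<^sup>2)"
  proof (rule sum.cong[OF refl])
    fix u
    have "(\<Sum>v\<in>UNIV. (M $ u $ v)\<^sup>2) = (\<Sum>v\<in>UNIV. if v = c then (1 / ?n\<^sup>2)\<^sup>2
        else if u = v then (1 - 1 / ?n - 1 / ?n\<^sup>2)\<^sup>2 else (1 / ?n + 1 / ?n\<^sup>2)\<^sup>2)" if "u \<noteq> c"
      using that by (intro sum.cong) (auto simp: M_def power2_eq_square algebra_simps)
    moreover have "(\<Sum>v\<in>UNIV. (M $ c $ v)\<^sup>2) = (\<Sum>v\<in>UNIV. if v = c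
        then (1 / ?n - 1 / ?n\<^sup>2)\<^sup>2 else (1 / ?n\<^sup>2)\<^sup>2)"
      by (intro sum.cong) (auto simp: M_def)
    ultimately show "(\<Sum>v\<in>UNIV. (M $ u $ v)\<^sup>2) = (if u = c
      then (1 / ?n - 1 / ?n\<^sup>2)\<^sup>2 + (?n - 1) * (1 / ?n\<^sup>2)\<^sup>2
      else (1 / ?n\<^sup>2)\<^sup>2 + (1 - 1 / ?n - 1 / ?n\<^sup>2)\<^sup>2 + (?n - 2) * (1 / ?n + 1 / ?n\<^sup>2)\<^sup>2)"
      by (cases "u = c") (simp_all only: sum1 sum2 if_True if_False simp_thms)
  qed
  also have "\<dots> = ?n - 2 + 1 / ?n\<^sup>2"
  proof -
    \<comment> \<open>With \<open>?n * y = 1\<close> as the only relation, the identity becomes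
      polynomial.\<close>
    define y where "y = 1 / ?n"
    have "?n * y = 1" using n by (simp add: y_def)
    then have "(y - y\<^sup>2)\<^sup>2 + (?n - 1) * (y\<^sup>2)\<^sup>2 + (?n - 1) *
        ((y\<^sup>2)\<^sup>2 + (1 - y - y\<^sup>2)\<^sup>2 + (?n - 2) * (y + y\<^sup>2)\<^sup>2) = ?n - 2 + y\<^sup>2"
      by algebra
    then show ?thesis unfolding sum1 by (simp add: y_def power_divide)
  qed
  finally show ?thesis using n by (simp add: algebra_simps power2_eq_square)
qed

section \<open>Strict comparison for trees of diameter at least 4\<close>

theorem biharmonic_index_star_less_tree:
  fixes T :: "'n::finite pair_pre_digraph" and c :: 'n
  assumes "undirected_tree T" "pverts T = UNIV" "graph_dist T u v > 3"
  shows "biharmonic_index (star_graph c) < biharmonic_index T"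
proof -
  let ?n = "real CARD('n)"
  note T = undirected_treeD[OF assms(1)]
  have far: "(u, v) \<notin> parcs T ^^ j" if "j < 4" for j
  proof
    assume "(u, v) \<in> parcs T ^^ j"
    then have "graph_dist T u v \<le> ereal (real j)"
      using graph_dist_le_relpow[OF T(1)] assms(2) by simp
    also have "\<dots> \<le> 3" using that by simp
    finally show False using assms(3) by simp
  qed
  have uv: "u \<noteq> v" using far[of 0] by auto
  have card: "CARD('n) \<ge> 2"
    using card_mono[of UNIV "{u, v}"] uv by simp
  have "\<exists>M. laplacian_pinv (laplacian T) M"
    using T(2) undirected_tree_reachable[OF assms(1)] assms(2)
    by (intro ex_laplacian_pinv transpose_laplacian laplacian_mult_averaging laplacian_kernel) auto
  then obtain M where M: "laplacian_pinv (laplacian T) M" ..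
  have "resistance M u v \<ge> 4"
    using resistance_tree_ge[OF assms(1,2) M, of 4] far by simp
  moreover have "trace M \<ge> ?n - 2 + 1 / ?n"
  proof -
    have "(?n - 1)\<^sup>2 / ?n = ?n - 2 + 1 / ?n"
      by (simp add: field_simps power2_eq_square)
    then show ?thesis using trace_pinv_tree_ge[OF assms(1,2) M] by simp
  qed
  \<comment> \<open>This is \<open>2 * (n - 2 + 1 / n) + 4 - n - 2\<close>; the star has
    \<open>1 / n\<^sup>2\<close> in place of \<open>2 / n\<close>.\<close>
  ultimately have "M \<bullet> M \<ge> ?n - 2 + 2 / ?n"
    using frobenius_pinv_ge[OF M uv] by simp
  moreover have "?n - 2 + 1 / ?n\<^sup>2 < ?n - 2 + 2 / ?n"
    using card by (simp add: field_simps power2_eq_square)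
  ultimately have "?n * (?n - 2 + 1 / ?n\<^sup>2) < ?n * (M \<bullet> M)" by simp
  moreover have "?n * (?n - 2 + 1 / ?n\<^sup>2) = biharmonic_index (star_graph c)"
    using biharmonic_index_star[OF card, of c] by (simp add: algebra_simps power2_eq_square)
  moreover have "biharmonic_index T = ?n * (M \<bullet> M)"
    using biharmonic_index_pinv[OF M] by (simp add: inner_vec_def power2_eq_square)
  ultimately show ?thesis by simp
qed

theorem theorem5p2:
  fixes T :: "'n::finite pair_pre_digraph" and c :: 'n and n :: nat
  assumes "undirected_tree T"
    and "pverts T = UNIV"
    and "CARD('n) = n"
    and "n \<ge> 8"
    and "graph_diameter T \<ge> ereal (pi * root 4 (7 * real n / 8) - 1)"
  shows "biharmonic_index T > biharmonic_index (star_graph c)"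
proof -
  \<comment> \<open>For \<open>n \<ge> 8\<close> the radicand is at least 7, while
    \<open>(8 / 5) ^ 4 = 6.5536\<close>; with \<open>pi > 3\<close> the threshold is at least 3.8,
    hence above 3.\<close>
  have "root 4 ((8 / 5) ^ 4) \<le> root 4 (7 * real n / 8)"
    using assms(4) by (intro real_root_le_mono) (simp_all add: power4_eq_xxxx)
  then have "8 / 5 \<le> root 4 (7 * real n / 8)" by (simp add: real_root_power_cancel)
  then have "3 * (8 / 5) \<le> pi * root 4 (7 * real n / 8)"
    using pi_gt3 by (intro mult_mono) auto
  then have "ereal 3 < ereal (pi * root 4 (7 * real n / 8) - 1)" by simp
  then have "3 < graph_diameter T" using assms(5) by (metis less_le_trans numeral_eq_ereal)
  then obtain u v where "3 < graph_dist T u v"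
    by (auto simp: graph_diameter_def less_SUP_iff)
  then show ?thesis using assms(1,2) by (rule biharmonic_index_star_less_tree[rotated 2])
qed

end
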